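(* Let $\Delta t>0$, $\beta>0$, $\mathcal J>0$, $n\ge1$, let $(\mathbf X_i^{m},\kappa_i^{m})_{0\le i\le M-1}$, $q^{m}$ for $m=n-1,n$ be given, and let $(\mathbf X_i^{n+1},V_i^{n+1},\kappa_i^{n+1})_{0\le i\le M-1}$, $q^{n+1}$ be a solution of the fully discrete A-RLM-BDF2-FDM scheme (equations (a)–(d) in the context). Define $$W_{\mathrm{RLM}}^{n}:=\frac{3W^{n}-W^{n-1}}{2}+\frac{3q^{n}-q^{n-1}-2}{2\beta}$$ and $W_{\mathrm{RLM}}^{n+1}$ by the same formula with $n$ replaced by $n+1$. Then the discrete energy stability law $$\frac{W_{\mathrm{RLM}}^{n+1}-W_{\mathrm{RLM}}^{n}}{\Delta t}=-\sum_{i=0}^{M-1}(V_i^{n+1})^2\,|\delta_\rho\mathbf X_i^{n+1}|\,\Delta\rho\le0$$ holds, which implies that the scheme is unconditionally energy stable, i.e. $W_{\mathrm{RLM}}^{n+1}\le W_{\mathrm{RLM}}^{n}$ with no restriction on $\Delta t$.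
   Context: Grid: $M\in\mathbb N$, $h=\Delta\rho=1/M$, nodes $\rho_i=ih$, $i=0,\dots,M-1$, with all indices understood periodically modulo $M$. A discrete closed curve at time level $n$ is a family $\mathbf X_i^n\in\mathbb R^2$. For scalar or vector grid functions $f$, $$\delta_\rho f_i=\frac{f_{i+1}-f_{i-1}}{2h},\qquad \delta_{\rho\rho}f_i=\frac{f_{i+1}-2f_i+f_{i-1}}{h^2}.$$ Discrete unit tangent and normal: $\boldsymbol\tau_i^n=\delta_\rho\mathbf X_i^n/|\delta_\rho\mathbf X_i^n|$ and $\mathbf n_i^n=R\boldsymbol\tau_i^n$ with $R=\begin{pmatrix}0&-1\\1&0\end{pmatrix}$ (it is understood that $\delta_\rho \mathbf X_i^n\ne0$ whenever it is divided by). $M_{f,i}^{n+1}>0$ are the nodal values of a monitor function, $P_i^{n+1}>0$ are the nodal values of a smoothing coefficient, $\mathcal J>0$ is a relaxation time constant and $\beta>0$ a relaxation parameter. The relaxation variable is initialized with $q^0=1$. Discrete Willmore energy: $W^n=\frac12\sum_{i=0}^{M-1}(\kappa_i^n)^2|\delta_\rho\mathbf X_i^n|\,\Delta\rho$. Put $$\mu_i^{n+1}=\frac{\delta_{\rho\rho}\kappa_i^{n+1}}{|\delta_\rho\mathbf X_i^{n+1}|^2}-\frac{\delta_\rho\kappa_i^{n+1}\,(\delta_\rho\mathbf X_i^{n+1}\cdot\delta_{\rho\rho}\mathbf X_i^{n+1})}{|\delta_\rho\mathbf X_i^{n+1}|^4}+\frac12(\kappa_i^{n+1})^3 .$$ The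 A-RLM-BDF2-FDM scheme is: for all $i$, (a) $\displaystyle \frac{3\mathbf X_i^{n+1}-4\mathbf X_i^n+\mathbf X_i^{n-1}}{2\Delta t}=V_i^{n+1}\mathbf n_i^{n+1}+\left[\left(\frac{P_i^{n+1}M_{f,i}^{n+1}}{\mathcal J\,(M_{f,i}^{n+1}|\delta_\rho\mathbf X_i^{n+1}|)^2}\,\delta_{\rho\rho}\mathbf X_i^{n+1}\right)\cdot\boldsymbol\tau_i^{n+1}+\frac{P_i^{n+1}\,\delta_\rho M_{f,i}^{n+1}\,|\delta_\rho\mathbf X_i^{n+1}|}{\mathcal J\,(M_{f,i}^{n+1}|\delta_\rho\mathbf X_i^{n+1}|)^2}\right]\boldsymbol\tau_i^{n+1}$, (b) $V_i^{n+1}=q^{n+1}\mu_i^{n+1}$, (c) $\displaystyle\kappa_i^{n+1}=-\frac{\delta_{\rho\rho}\mathbf X_i^{n+1}\cdot\mathbf n_i^{n+1}}{|\delta_\rho\mathbf X_i^{n+1}|^2}$, (d) $\displaystyle\frac{3q^{n+1}-4q^n+q^{n-1}}{2\Delta t}=-\beta\frac{3W^{n+1}-4W^n+W^{n-1}}{2\Delta t}-\beta\, q^{n+1}\sum_{i=0}^{M-1}\mu_i^{n+1}\left(\frac{3\mathbf X_i^{n+1}-4\mathbf X_i^n+\mathbf X_i^{n-1}}{2\Delta t}\cdot\mathbf n_i^{n+1}\right)|\delta_\rho\mathbf X_i^{n+1}|\,\Delta\rho$. *)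

theory Defs
  imports "HOL-Analysis.Analysis"
begin

text \<open>
  A grid function on the nodes $0, \dots, M-1$ is a function on \<^typ>\<open>nat\<close> of which only the values
  below \<open>M\<close> matter; neighbours are taken modulo \<open>M\<close>, the left one being
  \<open>(i + M - 1) mod M\<close> because subtraction on \<^typ>\<open>nat\<close> truncates.
  For time-dependent quantities the first index is the time level and the second the node.
\<close>

definition mesh :: "nat \<Rightarrow> real" where
  "mesh M = 1 / real M"

definition delta_rho :: "nat \<Rightarrow> (nat \<Rightarrow> 'a::real_vector) \<Rightarrow> nat \<Rightarrow> 'a" where
  "delta_rho M f i = (f ((i + 1) mod M) - f ((i + M - 1) mod M)) /\<^sub>R (2 * mesh M)"

definition delta_rho_rho :: "nat \<Rightarrow> (nat \<Rightarrow> 'a::real_vector) \<Rightarrow> nat \<Rightarrow> 'a" where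
  "delta_rho_rho M f i =
     (f ((i + 1) mod M) - 2 *\<^sub>R f i + f ((i + M - 1) mod M)) /\<^sub>R (mesh M)\<^sup>2"

definition rot :: "real^2^2" where
  "rot = vector [vector [0, - 1], vector [1, 0]]"

definition tangent :: "nat \<Rightarrow> (nat \<Rightarrow> real^2) \<Rightarrow> nat \<Rightarrow> real^2" where
  "tangent M X i = delta_rho M X i /\<^sub>R norm (delta_rho M X i)"

definition normal_vec :: "nat \<Rightarrow> (nat \<Rightarrow> real^2) \<Rightarrow> nat \<Rightarrow> real^2" where
  "normal_vec M X i = rot *v tangent M X i"

definition willmore :: "nat \<Rightarrow> (nat \<Rightarrow> real^2) \<Rightarrow> (nat \<Rightarrow> real) \<Rightarrow> real" where
  "willmore M X \<kappa> = 1 / 2 * (\<Sum>i<M. (\<kappa> i)\<^sup>2 * norm (delta_rho M X i) * mesh M)"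

definition mu :: "nat \<Rightarrow> (nat \<Rightarrow> real^2) \<Rightarrow> (nat \<Rightarrow> real) \<Rightarrow> nat \<Rightarrow> real" where
  "mu M X \<kappa> i =
     delta_rho_rho M \<kappa> i / (norm (delta_rho M X i))\<^sup>2
     - delta_rho M \<kappa> i * (delta_rho M X i \<bullet> delta_rho_rho M X i) / (norm (delta_rho M X i)) ^ 4
     + 1 / 2 * (\<kappa> i) ^ 3"

text \<open>Only meaningful for $n \ge 1$: approximates the time derivative at level $n + 1$
  from the levels $n + 1$, $n$, $n - 1$.\<close>

definition bdf2 :: "real \<Rightarrow> (nat \<Rightarrow> 'a::real_vector) \<Rightarrow> nat \<Rightarrow> 'a" where
  "bdf2 \<Delta>t u n = (3 *\<^sub>R u (n + 1) - 4 *\<^sub>R u n + u (n - 1)) /\<^sub>R (2 * \<Delta>t)"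

definition tangential_velocity ::
  "nat \<Rightarrow> real \<Rightarrow> (nat \<Rightarrow> real) \<Rightarrow> (nat \<Rightarrow> real) \<Rightarrow> (nat \<Rightarrow> real^2) \<Rightarrow> nat \<Rightarrow> real" where
  "tangential_velocity M J P Mf X i =
     ((P i * Mf i / (J * (Mf i * norm (delta_rho M X i))\<^sup>2)) *\<^sub>R delta_rho_rho M X i) \<bullet> tangent M X i
     + P i * delta_rho M Mf i * norm (delta_rho M X i) / (J * (Mf i * norm (delta_rho M X i))\<^sup>2)"

text \<open>One step of the scheme, from the levels $n - 1$, $n$ to the level $n + 1$ (for $n \ge 1$).\<close>

definition a_rlm_bdf2_fdm_step ::
  "nat \<Rightarrow> real \<Rightarrow> real \<Rightarrow> real \<Rightarrow> (nat \<Rightarrow> nat \<Rightarrow> real) \<Rightarrow> (nat \<Rightarrow> nat \<Rightarrow> real) \<Rightarrow>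
   (nat \<Rightarrow> nat \<Rightarrow> real^2) \<Rightarrow> (nat \<Rightarrow> nat \<Rightarrow> real) \<Rightarrow> (nat \<Rightarrow> nat \<Rightarrow> real) \<Rightarrow> (nat \<Rightarrow> real) \<Rightarrow>
   nat \<Rightarrow> bool" where
  "a_rlm_bdf2_fdm_step M \<Delta>t J \<beta> P Mf X V \<kappa> q n \<longleftrightarrow>
     (\<forall>i<M. bdf2 \<Delta>t (\<lambda>m. X m i) n =
        V (n + 1) i *\<^sub>R normal_vec M (X (n + 1)) i
        + tangential_velocity M J (P (n + 1)) (Mf (n + 1)) (X (n + 1)) i
            *\<^sub>R tangent M (X (n + 1)) i) \<and>
     (\<forall>i<M. V (n + 1) i = q (n + 1) * mu M (X (n + 1)) (\<kappa> (n + 1)) i) \<and>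
     (\<forall>i<M. \<kappa> (n + 1) i =
        - (delta_rho_rho M (X (n + 1)) i \<bullet> normal_vec M (X (n + 1)) i)
          / (norm (delta_rho M (X (n + 1)) i))\<^sup>2) \<and>
     bdf2 \<Delta>t q n =
       - \<beta> * bdf2 \<Delta>t (\<lambda>m. willmore M (X m) (\<kappa> m)) n
       - \<beta> * q (n + 1) *
           (\<Sum>i<M. mu M (X (n + 1)) (\<kappa> (n + 1)) i
                    * (bdf2 \<Delta>t (\<lambda>m. X m i) n \<bullet> normal_vec M (X (n + 1)) i)
                    * norm (delta_rho M (X (n + 1)) i) * mesh M)"

text \<open>Like \<^const>\<open>bdf2\<close>, only meaningful for $n \ge 1$.\<close>

definition W_RLM ::
  "nat \<Rightarrow> real \<Rightarrow> (nat \<Rightarrow> nat \<Rightarrow> real^2) \<Rightarrow> (nat \<Rightarrow> nat \<Rightarrow> real) \<Rightarrow> (nat \<Rightarrow> real) \<Rightarrow> nat \<Rightarrow> real" where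
  "W_RLM M \<beta> X \<kappa> q n =
     (3 * willmore M (X n) (\<kappa> n) - willmore M (X (n - 1)) (\<kappa> (n - 1))) / 2
     + (3 * q n - q (n - 1) - 2) / (2 * \<beta>)"

end

theory Submission
  imports Defs
begin

text \<open>
  The modified energy is built so that its increment over one step is $\Delta t$ times the
  BDF2 derivative of $W + q/\beta$, the constant $-2$ cancelling in the difference
  (\<open>W_RLM_increment\<close>).  Thus the relaxation equation, divided by $\beta$, already
  expresses the dissipation rate as
  $-q^{n+1} \sum_i \mu_i (\dot{X}_i \cdot n_i) |\delta_\rho X_i| \Delta\rho$, where $\dot{X}_i$
  is the BDF2 velocity.

  It remains to recognise this as a negative square.  Because $\tau_i$ and $n_i$ form an
  orthonormal frame, the normal component of the motion law is $V_i$, whatever the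
  mesh-redistributing tangential velocity is (\<open>step_normal_velocity\<close>); and the relaxed
  gradient flow sets $V_i = q^{n+1} \mu_i$.  So each summand is $V_i^2 |\delta_\rho X_i| \Delta\rho$.
\<close>

lemma normal_vec_orthogonal_tangent:
  "tangent M X i \<bullet> normal_vec M X i = 0"
  by (simp add: normal_vec_def rot_def inner_vec_def matrix_vector_mult_def sum_2 vector_2)

lemma normal_vec_unit:
  assumes "delta_rho M X i \<noteq> 0"
  shows "normal_vec M X i \<bullet> normal_vec M X i = 1"
proof -
  have "normal_vec M X i \<bullet> normal_vec M X i = tangent M X i \<bullet> tangent M X i"
    by (simp add: normal_vec_def rot_def inner_vec_def matrix_vector_mult_def sum_2 vector_2)
  also have "\<dots> = 1"
    using assms by (simp add: tangent_def dot_square_norm power2_eq_square)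
  finally show ?thesis .
qed

text \<open>
  Testing the motion law with the unit normal annihilates the tangential velocity, which moves
  nodes along the curve; only the motion of the curve itself enters the energy balance.
\<close>

lemma step_normal_velocity:
  assumes "a_rlm_bdf2_fdm_step M \<Delta>t J \<beta> P Mf X V \<kappa> q n"
    and "i < M" and "delta_rho M (X (n + 1)) i \<noteq> 0"
  shows "bdf2 \<Delta>t (\<lambda>m. X m i) n \<bullet> normal_vec M (X (n + 1)) i = V (n + 1) i"
proof -
  have "bdf2 \<Delta>t (\<lambda>m. X m i) n =
      V (n + 1) i *\<^sub>R normal_vec M (X (n + 1)) i
      + tangential_velocity M J (P (n + 1)) (Mf (n + 1)) (X (n + 1)) i
          *\<^sub>R tangent M (X (n + 1)) i"
    using assms(1,2) unfolding a_rlm_bdf2_fdm_step_def by blast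
  then show ?thesis
    using normal_vec_unit[OF assms(3)]
    by (simp add: inner_add_left normal_vec_orthogonal_tangent)
qed

text \<open>
  The weights $3/2, -1/2$ in the modified energy are the ones for which its backward difference
  is the BDF2 stencil: $(3a - b) - (3b - c) = 3a - 4b + c$.
\<close>

lemma W_RLM_increment:
  assumes "\<Delta>t \<noteq> 0"
  shows "(W_RLM M \<beta> X \<kappa> q (n + 1) - W_RLM M \<beta> X \<kappa> q n) / \<Delta>t
    = bdf2 \<Delta>t (\<lambda>m. willmore M (X m) (\<kappa> m)) n + bdf2 \<Delta>t q n / \<beta>"
  using assms by (cases "\<beta> = 0") (simp_all add: W_RLM_def bdf2_def field_simps)

theorem theorem4p3:
  fixes M n :: nat and \<Delta>t J \<beta> :: real
    and P Mf V \<kappa> :: "nat \<Rightarrow> nat \<Rightarrow> real"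
    and X :: "nat \<Rightarrow> nat \<Rightarrow> real^2"
    and q :: "nat \<Rightarrow> real"
  assumes "M \<ge> 1" and "n \<ge> 1"
    and "\<Delta>t > 0" and "\<beta> > 0" and "J > 0"
    and "\<And>i. i < M \<Longrightarrow> Mf (n + 1) i > 0"
    and "\<And>i. i < M \<Longrightarrow> P (n + 1) i > 0"
    and "q 0 = 1"
    and "\<And>i. i < M \<Longrightarrow> delta_rho M (X (n + 1)) i \<noteq> 0"
    and "a_rlm_bdf2_fdm_step M \<Delta>t J \<beta> P Mf X V \<kappa> q n"
  shows "(W_RLM M \<beta> X \<kappa> q (n + 1) - W_RLM M \<beta> X \<kappa> q n) / \<Delta>t
           = - (\<Sum>i<M. (V (n + 1) i)\<^sup>2 * norm (delta_rho M (X (n + 1)) i) * mesh M)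
         \<and> - (\<Sum>i<M. (V (n + 1) i)\<^sup>2 * norm (delta_rho M (X (n + 1)) i) * mesh M) \<le> 0
         \<and> W_RLM M \<beta> X \<kappa> q (n + 1) \<le> W_RLM M \<beta> X \<kappa> q n"
proof -
  let ?D = "\<Sum>i<M. (V (n + 1) i)\<^sup>2 * norm (delta_rho M (X (n + 1)) i) * mesh M"
  let ?S = "\<Sum>i<M. mu M (X (n + 1)) (\<kappa> (n + 1)) i
                    * (bdf2 \<Delta>t (\<lambda>m. X m i) n \<bullet> normal_vec M (X (n + 1)) i)
                    * norm (delta_rho M (X (n + 1)) i) * mesh M"
  let ?W = "bdf2 \<Delta>t (\<lambda>m. willmore M (X m) (\<kappa> m)) n"
  have V: "V (n + 1) i = q (n + 1) * mu M (X (n + 1)) (\<kappa> (n + 1)) i" if "i < M" for i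
    using assms(10) that unfolding a_rlm_bdf2_fdm_step_def by blast
  have relax: "bdf2 \<Delta>t q n = - \<beta> * ?W - \<beta> * q (n + 1) * ?S"
    using assms(10) unfolding a_rlm_bdf2_fdm_step_def by blast
  have dissipation: "q (n + 1) * ?S = ?D"
    unfolding sum_distrib_left
  proof (rule sum.cong[OF refl])
    fix i assume "i \<in> {..<M}"
    then have i: "i < M" by simp
    show "q (n + 1) * (mu M (X (n + 1)) (\<kappa> (n + 1)) i
            * (bdf2 \<Delta>t (\<lambda>m. X m i) n \<bullet> normal_vec M (X (n + 1)) i)
            * norm (delta_rho M (X (n + 1)) i) * mesh M)
        = (V (n + 1) i)\<^sup>2 * norm (delta_rho M (X (n + 1)) i) * mesh M"
      \<comment> \<open>One factor \<open>V\<close> comes from the motion law, the other from \<open>q * mu\<close>.\<close>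
      unfolding step_normal_velocity[OF assms(10) i assms(9)[OF i]] power2_eq_square
      by (subst (2) V[OF i]) (simp add: mult_ac)
  qed
  have "(W_RLM M \<beta> X \<kappa> q (n + 1) - W_RLM M \<beta> X \<kappa> q n) / \<Delta>t
      = ?W + (- \<beta> * ?W - \<beta> * (q (n + 1) * ?S)) / \<beta>"
    using assms(3) unfolding relax[symmetric, unfolded mult.assoc[of _ "q (n + 1)"]]
    by (intro W_RLM_increment) simp
  also have "\<dots> = - ?D"
    unfolding dissipation using assms(4) by (simp add: diff_divide_distrib)
  finally have law: "(W_RLM M \<beta> X \<kappa> q (n + 1) - W_RLM M \<beta> X \<kappa> q n) / \<Delta>t = - ?D" .
  have nonpos: "- ?D \<le> 0"
    by (simp add: sum_nonneg mesh_def)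
  have "W_RLM M \<beta> X \<kappa> q (n + 1) - W_RLM M \<beta> X \<kappa> q n \<le> 0"
    using law nonpos assms(3) by (metis divide_le_0_iff less_le_not_le)
  then show ?thesis
    using law nonpos by simp
qed

end
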